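(* Let $\Omega\subset\mathbb{R}^N$ be open, let $F:\mathcal{S}^N\times\mathbb{R}^N\times\mathbb{R}\times\Omega\to\mathbb{R}$ be continuous and degenerate elliptic, and let $u$ be a locally bounded, upper semicontinuous viscosity subsolution of $F(D^2u,Du,u,x)=0$ in $\Omega$. Assume that the properties (H1-2), (H2), (H3) stated in the context hold, for some $r_0>0$ and some $G_r$, $w_r$, $\eta_r$ ($0<r\le r_0$). Then: (1) For any $x\in\Omega$ and any $y\in B_r(x)$, where $r\le d(x)/2$ (and $0<r\le r_0$), one has $$u(y)\le u(x)+w_r(y-x).$$ (2) In particular, for any $\delta>0$, $u$ is uniformly continuous on $\overline{\Omega_\delta}$ and $w_{\delta/2}$ is a modulus of continuity of $u$ on $\overline{\Omega_\delta}$ (for $\delta/2\le r_0$, so that $w_{\delta/2}$ is defined; $w_{\delta/2}(s)$ being regarded as depending only on $|s|$, see the context). (3) Finally, if $\Omega$ is a $C^{1,1}$-domain and if $w_r(s)\le\tilde K|s|^\alpha$ for some $\tilde K>0$ and $0<\alpha\le1$ independent of $r$, then $u$ can be extended as a $C^{0,\alpha}$-function on $\overline\Omega$.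
   Context: $\mathcal{S}^N$ is the space of symmetric $N\times N$ real matrices; $B_r(x)$ is the open ball of center $x$ and radius $r$; $d$ is the distance function to $\partial\Omega$; $\Omega_\delta:=\{y\in\Omega: d(y)>\delta\}$. Degenerate ellipticity of $F$: $F(X,p,s,x)\le F(Y,p,s,x)$ whenever $X\ge Y$, for all $p,s,x$. Likewise, the ellipticity condition for $G_r$ is $G_r(X,p)\le G_r(Y,p)$ whenever $X\ge Y$. (H1-2) There exists $r_0>0$ and, for any $0<r\le r_0$, a continuous function $G_r:\mathcal{S}^N\times\mathbb{R}^N\to\mathbb{R}$ satisfying the ellipticity condition such that, for any $x\in\Omega$ with $d(x)\ge2r$, $G_r(D^2u,Du)\le0$ in $B_r(x)$ (in the viscosity sense). (H2) For any $0<r\le r_0$, there exists $w_r\in C(\overline{B_r(0)})$ such that $w_r(0)=0$, $w_r\ge0$ in $B_r(0)$ and $G_r(D^2w_r,Dw_r)\ge\eta_r>0$ on $\overline{B_r(0)}\setminus\{0\}$ for some $\eta_r>0$. This is a viscosity supersolution condition up to the boundary (state-constraint condition): for every smooth $\phi$ and every $x_0\in\overline{B_r(0)}\setminus\{0\}$ which is a local minimum point of $w_r-\phi$ relative to $\overline{B_r(0)}$, $G_r(D^2\phi(x_0),D\phi(x_0))\ge\eta_r$. (H3) If $v$ is a bounded upper semicontinuous viscosity subsolution of $G_r(D^2v,Dv)\le0$ in $B_r(0)\setminus\{0\}$, then $v(y)\le v(0)+w_r(y)$ in $B_r(0)$. Radial symmetry is not part of (H2): the paper remarks that $w_r$ can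 be assumed radially symmetric without loss of generality, since it can be replaced by $\tilde w_r(s):=\inf_{|y|=s}w_r(y)$, $0\le s\le r$, which still satisfies the supersolution condition. That $w_{\delta/2}$ is a modulus of continuity of $u$ on $\overline{\Omega_\delta}$ means that $|u(y)-u(x)|\le w_{\delta/2}(y-x)$ for $x,y\in\overline{\Omega_\delta}$ with $|x-y|<\delta/2$. A $C^{1,1}$-domain is one for which the distance function $d$ is $C^{1,1}$ in a neighborhood of $\partial\Omega$, say $\{x: d(x)<\delta_0\}$ (so that $n=-Dd$ is Lipschitz continuous there).
   Formalization: In (3), for unbounded Ω, "C^{0,α} on the closure" means Hölder on bounded subsets plus one constant for all pairs at small distance; a global constant fails (Ω=R^N, u linear, α<1). In (2) the modulus clause takes w_{δ/2} to be radial. *)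

theory Defs
  imports "HOL-Analysis.Analysis"
begin

definition symmetric_matrices :: "(real^'n^'n) set"
  where "symmetric_matrices = {X. Finite_Cartesian_Product.transpose X = X}"

definition loewner_le :: "real^'n^'n \<Rightarrow> real^'n^'n \<Rightarrow> bool"
  where "loewner_le Y X \<longleftrightarrow> (\<forall>\<xi>. \<xi> \<bullet> (Y *v \<xi>) \<le> \<xi> \<bullet> (X *v \<xi>))"

definition usc_on :: "'a::topological_space set \<Rightarrow> ('a \<Rightarrow> real) \<Rightarrow> bool"
  where "usc_on S f \<longleftrightarrow> (\<forall>x\<in>S. \<forall>a. f x < a \<longrightarrow> (\<forall>\<^sub>F y in at x within S. f y < a))"

definition locally_bounded_on :: "'a::metric_space set \<Rightarrow> ('a \<Rightarrow> real) \<Rightarrow> bool"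
  where "locally_bounded_on S f \<longleftrightarrow> (\<forall>x\<in>S. \<exists>e>0. bounded (f ` (ball x e \<inter> S)))"

text \<open>The function \<open>\<phi>\<close> is of class $C^2$ on the whole space, with gradient \<open>D\<phi>\<close> and
  Hessian \<open>D2\<phi>\<close>; the symmetry of \<open>D2\<phi> x\<close> is then automatic (Schwarz).\<close>

definition C2_function ::
    "(real^'n \<Rightarrow> real) \<Rightarrow> (real^'n \<Rightarrow> real^'n) \<Rightarrow> (real^'n \<Rightarrow> real^'n^'n) \<Rightarrow> bool"
  where "C2_function \<phi> D\<phi> D2\<phi> \<longleftrightarrow>
    (\<forall>x. GDERIV \<phi> x :> D\<phi> x) \<and>
    (\<forall>x. (D\<phi> has_derivative (\<lambda>h. D2\<phi> x *v h)) (at x)) \<and>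
    continuous_on UNIV D2\<phi>"

text \<open>Viscosity subsolutions of $F(D^2u,Du,u,x) = 0$ in an open set \<open>U\<close>. Upper semicontinuity
  is not built in. Since maxima are local, it makes no difference whether the test functions are
  $C^2$ on \<open>U\<close> or on the whole space.\<close>

definition viscosity_subsolution ::
    "(real^'n^'n \<Rightarrow> real^'n \<Rightarrow> real \<Rightarrow> real^'n \<Rightarrow> real) \<Rightarrow> (real^'n) set \<Rightarrow> (real^'n \<Rightarrow> real) \<Rightarrow> bool"
  where "viscosity_subsolution F U u \<longleftrightarrow>
    (\<forall>\<phi> D\<phi> D2\<phi> x\<^sub>0. C2_function \<phi> D\<phi> D2\<phi> \<and> x\<^sub>0 \<in> U \<and>
       (\<forall>\<^sub>F y in at x\<^sub>0 within U. u y - \<phi> y \<le> u x\<^sub>0 - \<phi> x\<^sub>0) \<longrightarrow>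
       F (D2\<phi> x\<^sub>0) (D\<phi> x\<^sub>0) (u x\<^sub>0) x\<^sub>0 \<le> 0)"

text \<open>State-constraint supersolutions of $G(D^2w,Dw) \ge \eta$ on \<open>K - {0}\<close>: minimum points may
  lie on the boundary of \<open>K\<close>, and minimality is only relative to \<open>K\<close>.\<close>

definition state_constraint_supersolution ::
    "(real^'n^'n \<Rightarrow> real^'n \<Rightarrow> real) \<Rightarrow> real \<Rightarrow> (real^'n) set \<Rightarrow> (real^'n \<Rightarrow> real) \<Rightarrow> bool"
  where "state_constraint_supersolution G \<eta> K w \<longleftrightarrow>
    (\<forall>\<phi> D\<phi> D2\<phi> x\<^sub>0. C2_function \<phi> D\<phi> D2\<phi> \<and> x\<^sub>0 \<in> K - {0} \<and>
       (\<forall>\<^sub>F y in at x\<^sub>0 within K. w x\<^sub>0 - \<phi> x\<^sub>0 \<le> w y - \<phi> y) \<longrightarrow>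
       \<eta> \<le> G (D2\<phi> x\<^sub>0) (D\<phi> x\<^sub>0))"

text \<open>Distance to the boundary, infinite if the boundary is empty (where \<open>infdist\<close> would
  return \<open>0\<close>).\<close>

definition bdry_dist :: "'a::metric_space set \<Rightarrow> 'a \<Rightarrow> ereal"
  where "bdry_dist \<Omega> x =
    (if frontier \<Omega> = {} then \<infinity> else ereal (infdist x (frontier \<Omega>)))"

definition inner_set :: "'a::metric_space set \<Rightarrow> real \<Rightarrow> 'a set"
  where "inner_set \<Omega> \<delta> = {y \<in> \<Omega>. bdry_dist \<Omega> y > ereal \<delta>}"

text \<open>The distance is required to be $C^{1,1}$ on the \<open>\<Omega>\<close>-side of the boundary only: the unsigned
  distance is never differentiable across the boundary, and the corresponding requirement on the
  signed distance in a two-sided neighbourhood is stronger.\<close>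

definition C11_domain :: "(real^'n) set \<Rightarrow> bool"
  where "C11_domain \<Omega> \<longleftrightarrow> open \<Omega> \<and>
    (\<exists>\<delta>\<^sub>0>0. \<exists>Dd L.
       (\<forall>x\<in>{x \<in> \<Omega>. bdry_dist \<Omega> x < ereal \<delta>\<^sub>0}. GDERIV (\<lambda>y. infdist y (frontier \<Omega>)) x :> Dd x) \<and>
       L-lipschitz_on {x \<in> \<Omega>. bdry_dist \<Omega> x < ereal \<delta>\<^sub>0} Dd)"

definition holder_on :: "real \<Rightarrow> 'a::metric_space set \<Rightarrow> ('a \<Rightarrow> real) \<Rightarrow> bool"
  where "holder_on \<alpha> S f \<longleftrightarrow>
    (\<exists>C\<ge>0. \<forall>x\<in>S. \<forall>y\<in>S. \<bar>f x - f y\<bar> \<le> C * dist x y powr \<alpha>)"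

text \<open>$C^{0,\alpha}$ on a possibly unbounded set: the usual global condition on every bounded
  subset (hence on \<open>S\<close> itself if \<open>S\<close> is bounded), and a uniform constant for all pairs of points
  at small distance. A global constant cannot be expected when \<open>S\<close> is unbounded, since a linear
  function is not globally \<open>\<alpha>\<close>-Hoelder for \<open>\<alpha> < 1\<close>.\<close>

definition C0_alpha_on :: "real \<Rightarrow> 'a::metric_space set \<Rightarrow> ('a \<Rightarrow> real) \<Rightarrow> bool"
  where "C0_alpha_on \<alpha> S f \<longleftrightarrow>
    (\<forall>T\<subseteq>S. bounded T \<longrightarrow> holder_on \<alpha> T f) \<and>
    (\<exists>C\<ge>0. \<exists>\<rho>>0. \<forall>x\<in>S. \<forall>y\<in>S. dist x y < \<rho> \<longrightarrow> \<bar>f x - f y\<bar> \<le> C * dist x y powr \<alpha>)"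

end

theory Submission
  imports Defs
begin

text \<open>
  Translated to the origin, \<open>u\<close> is on each ball with \<open>2 * r \<le> d(x)\<close> a bounded upper
  semicontinuous subsolution of the equation of \<open>G r\<close>, so the comparison property with
  \<open>w r\<close> is the first claim. The estimate is one-sided, but when both points are far from the
  boundary they can be exchanged. Since \<open>w r\<close> is continuous and vanishes at the origin, this
  gives uniform continuity on the inner sets, and the two-sided modulus when \<open>w r\<close> is radial.

  For the last claim, \<open>w r\<close> being bounded by a power independent of \<open>r\<close>, the first claim says
  that \<open>u x\<close> and \<open>u y\<close> differ by at most \<open>K * dist x y powr \<alpha>\<close> as soon as
  \<open>dist x y\<close> is less than \<open>r\<^sub>0\<close> and than half the distance of both points to the
  boundary. The problem is to remove this last restriction. In a domain of class \<open>C^{1,1}\<close> the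
  gradient of the distance is, near the boundary, a Lipschitz unit field along which one moves away
  from the boundary at a rate of at least 1/2
  (\<open>C11_domain_inward_field\<close>). On such a ray, which may start arbitrarily close to the boundary,
  the interior estimates between geometrically spaced points sum up to a Hoelder estimate
  (\<open>holder_along_ray\<close>). Two points at distance \<open>t\<close> near the boundary are then compared by
  first pushing both inward by a multiple of \<open>t\<close>
  (\<open>uniform_holder_if_interior_holder\<close>). The constant is uniform, hence \<open>u\<close> is uniformly
  continuous and extends to the closure, and the estimate passes to the limit
  (\<open>C0_alpha_on_closure_extension\<close>).
\<close>

section \<open>Boundary distance and local hypotheses on compact balls\<close>

text \<open>A closed ball of radius below the distance to the boundary stays in the domain; this turns
  the local boundedness of \<open>u\<close> into the boundedness on a whole ball required by the
  comparison property.\<close>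

lemma cball_subset_if_lt_bdry_dist:
  fixes \<Omega> :: "'a::real_normed_vector set"
  assumes "x \<in> \<Omega>" "ereal r < bdry_dist \<Omega> x"
  shows "cball x r \<subseteq> \<Omega>"
proof (rule ccontr)
  assume outside: "\<not> cball x r \<subseteq> \<Omega>"
  then have "0 \<le> r"
    by force
  \<comment> \<open>A connected set that meets both \<open>\<Omega>\<close> and its complement meets the boundary.\<close>
  then have "cball x r \<inter> frontier \<Omega> \<noteq> {}"
    using outside assms(1) centre_in_cball[of x r] by (intro connected_Int_frontier) blast+
  then obtain p where p: "p \<in> frontier \<Omega>" "dist x p \<le> r"
    by auto
  then have "infdist x (frontier \<Omega>) \<le> r"
    using infdist_le2 by metis
  then show False
    using assms(2) p(1) by (auto simp: bdry_dist_def split: if_splits)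
qed

lemma locally_bounded_on_compact_subset:
  assumes "locally_bounded_on \<Omega> u" "compact S" "S \<subseteq> \<Omega>"
  shows "bounded (u ` S)"
proof -
  have "\<forall>x\<in>S. \<exists>e>0. bounded (u ` (ball x e \<inter> \<Omega>))"
    using assms(1,3) unfolding locally_bounded_on_def by blast
  then obtain e where e: "\<And>x. x \<in> S \<Longrightarrow> e x > 0"
      "\<And>x. x \<in> S \<Longrightarrow> bounded (u ` (ball x (e x) \<inter> \<Omega>))"
    using bchoice[of S "\<lambda>x e. e > 0 \<and> bounded (u ` (ball x e \<inter> \<Omega>))"] by blast
  have "S \<subseteq> (\<Union>x\<in>S. ball x (e x))"
    using e by force
  then obtain C where C: "C \<subseteq> S" "finite C" "S \<subseteq> (\<Union>x\<in>C. ball x (e x))"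
    using compactE_image[OF assms(2), of S "\<lambda>x. ball x (e x)"] by auto
  have "u ` S \<subseteq> (\<Union>x\<in>C. u ` (ball x (e x) \<inter> \<Omega>))"
    using C(3) assms(3) by blast
  moreover have "bounded (\<Union>x\<in>C. u ` (ball x (e x) \<inter> \<Omega>))"
    using C e by (intro bounded_UN) auto
  ultimately show ?thesis
    using bounded_subset by blast
qed

section \<open>Translation of viscosity subsolutions\<close>

lemma eventually_at_translate:
  fixes x z :: "'a::real_normed_vector"
  shows "(\<forall>\<^sub>F y in at (x + z). P y) \<longleftrightarrow> (\<forall>\<^sub>F y in at z. P (x + y))"
  using eventually_at_to_0[of P "x + z"] eventually_at_to_0[of "\<lambda>y. P (x + y)" z]
  by (simp add: algebra_simps)

lemma usc_on_translate:
  fixes u :: "'a::real_normed_vector \<Rightarrow> real"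
  assumes "usc_on \<Omega> u" "ball x r \<subseteq> \<Omega>"
  shows "usc_on (ball 0 r) (\<lambda>z. u (x + z))"
  unfolding usc_on_def
proof (intro ballI allI impI)
  fix z a
  assume z: "z \<in> ball 0 r" and "u (x + z) < a"
  then have xz: "x + z \<in> ball x r"
    by (simp add: dist_norm)
  then have "\<forall>\<^sub>F y in at (x + z) within \<Omega>. u y < a"
    using assms \<open>u (x + z) < a\<close> unfolding usc_on_def by blast
  then have "\<forall>\<^sub>F y in at (x + z) within ball x r. u y < a"
    using assms(2) at_le filter_leD by blast
  then have "\<forall>\<^sub>F y in at (x + z). u y < a"
    by (simp only: at_within_open[OF xz open_ball])
  then show "\<forall>\<^sub>F y in at z within ball 0 r. u (x + y) < a"
    by (simp only: at_within_open[OF z open_ball] eventually_at_translate)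
qed

lemma C2_function_translate:
  assumes "C2_function \<phi> D\<phi> D2\<phi>"
  shows "C2_function (\<lambda>z. \<phi> (z - x)) (\<lambda>z. D\<phi> (z - x)) (\<lambda>z. D2\<phi> (z - x))"
  unfolding C2_function_def
proof (intro conjI allI)
  have shift: "((\<lambda>z. z - x) has_derivative (\<lambda>h. h)) (at z)" for z
    by (auto intro!: derivative_eq_intros)
  fix z
  have "(\<phi> has_derivative (\<lambda>h. h \<bullet> D\<phi> (z - x))) (at (z - x))"
    using assms by (simp add: C2_function_def gderiv_def inner_commute)
  from has_derivative_compose[OF shift this]
  show "GDERIV (\<lambda>z. \<phi> (z - x)) z :> D\<phi> (z - x)"
    by (simp add: gderiv_def inner_commute)
  have "(D\<phi> has_derivative (\<lambda>h. D2\<phi> (z - x) *v h)) (at (z - x))"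
    using assms by (simp add: C2_function_def)
  from has_derivative_compose[OF shift this]
  show "((\<lambda>z. D\<phi> (z - x)) has_derivative (\<lambda>h. D2\<phi> (z - x) *v h)) (at z)" .
next
  have "continuous_on UNIV D2\<phi>"
    using assms by (simp add: C2_function_def)
  then show "continuous_on UNIV (\<lambda>z. D2\<phi> (z - x))"
    by (rule continuous_on_compose2) (auto intro!: continuous_intros)
qed

text \<open>The comparison property concerns balls centred at the origin, punctured there. An operator
  without dependence on the point is translation invariant, and puncturing only removes
  tests.\<close>

lemma viscosity_subsolution_translate:
  fixes u :: "real^'n \<Rightarrow> real"
  assumes "viscosity_subsolution (\<lambda>X p s y. H X p) (ball x r) u"
  shows "viscosity_subsolution (\<lambda>X p s y. H X p) (ball 0 r - {0}) (\<lambda>z. u (x + z))"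
  unfolding viscosity_subsolution_def
proof (intro allI impI, elim conjE)
  fix \<phi> D\<phi> D2\<phi> z
  assume \<phi>: "C2_function \<phi> D\<phi> D2\<phi>" and z: "z \<in> ball 0 r - {0}"
    and "\<forall>\<^sub>F y in at z within ball 0 r - {0}. u (x + y) - \<phi> y \<le> u (x + z) - \<phi> z"
  then have "\<forall>\<^sub>F y in at z. u (x + y) - \<phi> (x + y - x) \<le> u (x + z) - \<phi> (x + z - x)"
    using at_within_open[OF z] by (simp add: open_delete)
  then have "\<forall>\<^sub>F y in at (x + z). u y - \<phi> (y - x) \<le> u (x + z) - \<phi> (x + z - x)"
    by (subst eventually_at_translate)
  then have max: "\<forall>\<^sub>F y in at (x + z) within ball x r.
      u y - \<phi> (y - x) \<le> u (x + z) - \<phi> (x + z - x)"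
    using at_le[OF subset_UNIV] filter_leD by blast
  have "x + z \<in> ball x r"
    using z by (simp add: dist_norm)
  then show "H (D2\<phi> z) (D\<phi> z) \<le> 0"
    using assms[unfolded viscosity_subsolution_def, rule_format, OF conjI, OF C2_function_translate[OF \<phi>] conjI, OF _ max]
    by simp
qed

section \<open>Uniform continuity on inner sets\<close>

lemma uniformly_continuous_on_if_modulus:
  fixes u :: "'a::real_normed_vector \<Rightarrow> real"
  assumes "r > 0" and cont: "continuous_on (cball 0 r) \<omega>" and "\<omega> 0 = 0"
    and modulus: "\<And>x y. \<lbrakk>x \<in> S; y \<in> S; dist x y < r\<rbrakk> \<Longrightarrow> u y \<le> u x + \<omega> (y - x)"
  shows "uniformly_continuous_on S u"
  unfolding uniformly_continuous_on_def
proof (intro allI impI)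
  fix \<epsilon> :: real assume "\<epsilon> > 0"
  then obtain \<delta> where \<delta>: "\<delta> > 0"
      "\<And>z. \<lbrakk>z \<in> cball 0 r; dist z 0 < \<delta>\<rbrakk> \<Longrightarrow> dist (\<omega> z) (\<omega> 0) < \<epsilon>"
    using cont \<open>r > 0\<close> unfolding continuous_on_iff by (metis centre_in_cball less_imp_le)
  have close: "u y < u x + \<epsilon>" if "x \<in> S" "y \<in> S" "dist x y < min r \<delta>" for x y
  proof -
    have "\<omega> (y - x) < \<epsilon>"
      using \<delta>(2)[of "y - x"] that \<open>\<omega> 0 = 0\<close>
      by (simp add: dist_norm norm_minus_commute)
    then show ?thesis
      using modulus[of x y] that by simp
  qed
  have "dist (u y) (u x) < \<epsilon>" if "x \<in> S" "y \<in> S" "dist y x < min r \<delta>" for x y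
    using close[of x y] close[of y x] that by (simp add: dist_real_def dist_commute abs_less_iff)
  then show "\<exists>\<delta>>0. \<forall>x\<in>S. \<forall>y\<in>S. dist y x < \<delta> \<longrightarrow> dist (u y) (u x) < \<epsilon>"
    using \<open>r > 0\<close> \<delta>(1) by (intro exI[of _ "min r \<delta>"]) auto
qed

lemma mem_closure_inner_setD:
  assumes "open \<Omega>" "\<delta> > 0" "x \<in> closure (inner_set \<Omega> \<delta>)"
  shows "x \<in> \<Omega>" "ereal \<delta> \<le> bdry_dist \<Omega> x"
proof -
  have "inner_set \<Omega> \<delta> \<subseteq> \<Omega>"
    by (auto simp: inner_set_def)
  then have closure: "x \<in> closure \<Omega>"
    using assms(3) closure_mono by blast
  show le: "ereal \<delta> \<le> bdry_dist \<Omega> x"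
  proof (cases "frontier \<Omega> = {}")
    case False
    have "closed {y. \<delta> \<le> infdist y (frontier \<Omega>)}"
      by (intro closed_Collect_le continuous_intros)
    moreover have "inner_set \<Omega> \<delta> \<subseteq> {y. \<delta> \<le> infdist y (frontier \<Omega>)}"
      using False by (auto simp: inner_set_def bdry_dist_def)
    ultimately have "closure (inner_set \<Omega> \<delta>) \<subseteq> {y. \<delta> \<le> infdist y (frontier \<Omega>)}"
      by (rule closure_minimal[rotated])
    then show ?thesis
      using assms(3) by (auto simp: bdry_dist_def)
  qed (simp add: bdry_dist_def)
  have "x \<notin> frontier \<Omega>"
    using le assms(2) by (auto simp: bdry_dist_def split: if_splits)
  then show "x \<in> \<Omega>"
    using closure assms(1) by (auto simp: frontier_def interior_open)
qed

lemma open_inner_set: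
  assumes "open \<Omega>"
  shows "open (inner_set \<Omega> \<delta>)"
proof (cases "frontier \<Omega> = {}")
  case False
  then have "inner_set \<Omega> \<delta> = \<Omega> \<inter> {y. \<delta> < infdist y (frontier \<Omega>)}"
    by (auto simp: inner_set_def bdry_dist_def)
  moreover have "open {y. \<delta> < infdist y (frontier \<Omega>)}"
    by (intro open_Collect_less continuous_intros)
  ultimately show ?thesis
    using assms by (simp add: open_Int)
qed (use assms in \<open>simp add: inner_set_def bdry_dist_def\<close>)

text \<open>Exhausting the domain in this way makes uniform continuity on each inner set imply continuity on
  the whole domain.\<close>

lemma UN_inner_set:
  assumes "open \<Omega>"
  shows "(\<Union>\<delta>\<in>{0<..}. inner_set \<Omega> \<delta>) = \<Omega>"
proof
  show "\<Omega> \<subseteq> (\<Union>\<delta>\<in>{0<..}. inner_set \<Omega> \<delta>)"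
  proof
    fix x assume x: "x \<in> \<Omega>"
    then have "x \<notin> frontier \<Omega>"
      using assms frontier_disjoint_eq by blast
    then have "frontier \<Omega> = {} \<or> infdist x (frontier \<Omega>) > 0"
      using infdist_pos_not_in_closed[of "frontier \<Omega>" x] by auto
    then obtain \<delta> where "\<delta> > 0" "frontier \<Omega> = {} \<or> \<delta> < infdist x (frontier \<Omega>)"
      using dense zero_less_one by metis
    then show "x \<in> (\<Union>\<delta>\<in>{0<..}. inner_set \<Omega> \<delta>)"
      using x by (auto simp: inner_set_def bdry_dist_def)
  qed
qed (auto simp: inner_set_def)

section \<open>The inward field of a \<open>C^{1,1}\<close> domain\<close>

text \<open>The upper bound \<open>norm g \<le> 1\<close> is the 1-Lipschitz property of the distance. For the lower
  bound, the distance decreases with unit speed on the segment from \<open>x\<close> to a nearest point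
  \<open>p\<close> of \<open>S\<close>, so the derivative in that unit direction is at most \<open>- 1\<close>.\<close>

lemma norm_gradient_of_infdist:
  fixes S :: "'a::euclidean_space set"
  assumes S: "closed S" "S \<noteq> {}" and x: "x \<notin> S"
    and grad: "GDERIV (\<lambda>y. infdist y S) x :> g"
  shows "norm g = 1"
proof -
  define f where "f y = infdist y S" for y
  have quot: "((\<lambda>\<tau>. (f (x + \<tau> *\<^sub>R v) - f x) / \<tau>) \<longlongrightarrow> v \<bullet> g) (at_right 0)" for v
  proof -
    have "(f has_derivative (\<lambda>h. h \<bullet> g)) (at (x + 0 *\<^sub>R v))"
      using grad by (simp add: gderiv_def inner_commute f_def[abs_def])
    moreover have "((\<lambda>\<tau>. x + \<tau> *\<^sub>R v) has_derivative (\<lambda>\<tau>. \<tau> *\<^sub>R v)) (at 0)"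
      by (auto intro!: derivative_eq_intros)
    ultimately have "((\<lambda>\<tau>. f (x + \<tau> *\<^sub>R v)) has_derivative (\<lambda>\<tau>. \<tau> *\<^sub>R v \<bullet> g)) (at 0)"
      by (rule has_derivative_compose[rotated])
    then have "((\<lambda>\<tau>. f (x + \<tau> *\<^sub>R v)) has_real_derivative v \<bullet> g) (at 0)"
      by (rule has_derivative_imp_has_field_derivative) simp
    then have "((\<lambda>\<tau>. f (x + \<tau> *\<^sub>R v)) has_real_derivative v \<bullet> g) (at_right 0)"
      by (rule has_field_derivative_at_within)
    then show ?thesis
      by (simp add: has_field_derivative_iff)
  qed
  obtain p where p: "p \<in> S" "f x = dist x p"
    using infdist_attains_inf[OF S] unfolding f_def by metis
  define e where "e = (1 / norm (p - x)) *\<^sub>R (p - x)"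
  have e: "norm e = 1" "p = x + f x *\<^sub>R e" and fx: "f x > 0"
    using p x by (auto simp: e_def dist_norm norm_minus_commute)
  have lin: "f (x + \<tau> *\<^sub>R e) = f x - \<tau>" if "0 \<le> \<tau>" "\<tau> \<le> f x" for \<tau>
  proof (rule antisym)
    have "f (x + \<tau> *\<^sub>R e) \<le> dist (x + \<tau> *\<^sub>R e) p"
      using p(1) by (simp add: f_def infdist_le)
    also have "\<dots> = norm ((\<tau> - f x) *\<^sub>R e)"
      by (subst e(2)) (simp add: dist_norm algebra_simps)
    also have "\<dots> = f x - \<tau>"
      using that e(1) by simp
    finally show "f (x + \<tau> *\<^sub>R e) \<le> f x - \<tau>" .
    have "f x \<le> f (x + \<tau> *\<^sub>R e) + dist x (x + \<tau> *\<^sub>R e)"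
      unfolding f_def by (rule infdist_triangle)
    then show "f x - \<tau> \<le> f (x + \<tau> *\<^sub>R e)"
      using that e(1) by (simp add: dist_norm)
  qed
  have "((\<lambda>\<tau>. (f (x + \<tau> *\<^sub>R e) - f x) / \<tau>) \<longlongrightarrow> e \<bullet> g) (at_right 0)"
    by (rule quot)
  moreover have "\<forall>\<^sub>F \<tau> in at_right 0. (f (x + \<tau> *\<^sub>R e) - f x) / \<tau> \<le> - 1"
    unfolding eventually_at_right_field using fx lin by (intro exI[of _ "f x"]) auto
  ultimately have "e \<bullet> g \<le> - 1"
    by (rule tendsto_upperbound) simp
  then have "1 \<le> norm g"
    using Cauchy_Schwarz_ineq2[of e g] e(1) by simp
  moreover have "norm g \<le> 1"
  proof -
    have "((\<lambda>\<tau>. (f (x + \<tau> *\<^sub>R g) - f x) / \<tau>) \<longlongrightarrow> g \<bullet> g) (at_right 0)"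
      by (rule quot)
    moreover have "\<forall>\<^sub>F \<tau> in at_right 0. (f (x + \<tau> *\<^sub>R g) - f x) / \<tau> \<le> norm g"
      unfolding eventually_at_right_field
    proof (intro exI[of _ 1] conjI allI impI)
      fix \<tau> :: real assume "0 < \<tau>"
      have "f (x + \<tau> *\<^sub>R g) \<le> f x + dist (x + \<tau> *\<^sub>R g) x"
        unfolding f_def by (rule infdist_triangle)
      then show "(f (x + \<tau> *\<^sub>R g) - f x) / \<tau> \<le> norm g"
        using \<open>0 < \<tau>\<close> by (simp add: dist_norm divide_le_eq mult.commute)
    qed simp
    ultimately have "g \<bullet> g \<le> norm g"
      by (rule tendsto_upperbound) simp
    then show ?thesis
      by (cases "g = 0") (auto simp: dot_square_norm power2_eq_square)
  qed
  ultimately show ?thesis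
    by simp
qed

text \<open>The regularity of the boundary enters only here. Moving from \<open>x\<close> along the inward unit vector
  \<open>\<nu> x\<close>, the gradient of the distance \<open>d\<close>, the derivative of \<open>d\<close> is the inner
  product of \<open>\<nu> x\<close> with the gradient at the current point. It equals 1 at the start and,
  since the gradient is Lipschitz, stays at least 1/2 for a time that does not depend on \<open>x\<close>.\<close>

lemma C11_domain_inward_field:
  fixes \<Omega> :: "(real^'n) set"
  assumes "C11_domain \<Omega>" "frontier \<Omega> \<noteq> {}"
  obtains L s\<^sub>0 \<nu> where "L \<ge> 0" "s\<^sub>0 > 0"
    and "L-lipschitz_on {x \<in> \<Omega>. infdist x (frontier \<Omega>) < s\<^sub>0} \<nu>"
    and "\<And>x. \<lbrakk>x \<in> \<Omega>; infdist x (frontier \<Omega>) < s\<^sub>0\<rbrakk> \<Longrightarrow> norm (\<nu> x) = 1"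
    and "\<And>x \<tau>. \<lbrakk>x \<in> \<Omega>; infdist x (frontier \<Omega>) < s\<^sub>0; 0 \<le> \<tau>; \<tau> \<le> s\<^sub>0\<rbrakk>
      \<Longrightarrow> x + \<tau> *\<^sub>R \<nu> x \<in> \<Omega> \<and>
          infdist x (frontier \<Omega>) + \<tau> / 2 \<le> infdist (x + \<tau> *\<^sub>R \<nu> x) (frontier \<Omega>)"
proof -
  define d where "d y = infdist y (frontier \<Omega>)" for y
  have d_dist: "d y \<le> d z + dist y z" for y z
    unfolding d_def by (rule infdist_triangle)
  have cont_d: "continuous_on A d" for A
    unfolding d_def by (intro continuous_intros)
  obtain \<delta> \<nu> L where "open \<Omega>" and \<delta>: "\<delta> > 0"
    and grad: "\<And>x. \<lbrakk>x \<in> \<Omega>; d x < \<delta>\<rbrakk> \<Longrightarrow> GDERIV d x :> \<nu> x"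
    and lip: "L-lipschitz_on {x \<in> \<Omega>. d x < \<delta>} \<nu>"
    using assms unfolding C11_domain_def bdry_dist_def d_def[abs_def] by auto
  have L: "L \<ge> 0"
    using lip by (rule lipschitz_on_nonneg)
  have disjoint: "x \<notin> frontier \<Omega>" if "x \<in> \<Omega>" for x
    using \<open>open \<Omega>\<close> that frontier_disjoint_eq by blast
  have unit: "norm (\<nu> x) = 1" if "x \<in> \<Omega>" "d x < \<delta>" for x
    using grad[OF that] assms(2) disjoint[OF that(1)] unfolding d_def[abs_def]
    by (intro norm_gradient_of_infdist[of "frontier \<Omega>" x]) auto
  \<comment> \<open>The first bound keeps rays of length \<open>s\<^sub>0\<close> that start in the \<open>s\<^sub>0\<close>-strip inside the
      \<open>\<delta>\<close>-strip; the second keeps the gradient within 1/2 of its initial value.\<close>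
  define s\<^sub>0 where "s\<^sub>0 = min (\<delta> / 2) (1 / (2 * (L + 1)))"
  have s\<^sub>0: "s\<^sub>0 > 0" "s\<^sub>0 \<le> \<delta> / 2" "L * s\<^sub>0 \<le> 1 / 2"
  proof -
    show "s\<^sub>0 > 0" "s\<^sub>0 \<le> \<delta> / 2"
      using \<delta> L by (auto simp: s\<^sub>0_def)
    have "L * s\<^sub>0 \<le> L * (1 / (2 * (L + 1)))"
      using L by (intro mult_left_mono) (auto simp: s\<^sub>0_def)
    also have "\<dots> \<le> 1 / 2"
      using L by (simp add: field_simps)
    finally show "L * s\<^sub>0 \<le> 1 / 2" .
  qed
  have ray: "x + \<tau> *\<^sub>R \<nu> x \<in> \<Omega> \<and> d x + \<tau> / 2 \<le> d (x + \<tau> *\<^sub>R \<nu> x)"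
    if x: "x \<in> \<Omega>" "d x < s\<^sub>0" and \<tau>: "0 \<le> \<tau>" "\<tau> \<le> s\<^sub>0" for x \<tau>
  proof -
    define \<gamma> where "\<gamma> t = x + t *\<^sub>R \<nu> x" for t
    have dx: "d x < \<delta>"
      using x s\<^sub>0 \<delta> by linarith
    have cont_\<gamma>: "continuous_on A \<gamma>" for A
      unfolding \<gamma>_def by (intro continuous_intros)
    have norm_\<nu>: "norm (\<nu> x) = 1"
      using unit x dx by blast
    have strip: "d (\<gamma> t) < \<delta>" if "0 \<le> t" "t \<le> s\<^sub>0" for t
      using d_dist[of "\<gamma> t" x] that x(2) s\<^sub>0(2) norm_\<nu> by (simp add: \<gamma>_def dist_norm)
    have growth: "d x + b / 2 \<le> d (\<gamma> b)"
      if b: "0 \<le> b" "b \<le> s\<^sub>0" and inside: "\<And>t. \<lbrakk>0 \<le> t; t < b\<rbrakk> \<Longrightarrow> \<gamma> t \<in> \<Omega>" for b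
    proof (cases "b = 0")
      case False
      have der: "((\<lambda>t. d (\<gamma> t)) has_derivative (\<lambda>h. h * (\<nu> x \<bullet> \<nu> (\<gamma> t)))) (at t)"
        if "0 < t" "t < b" for t
      proof -
        have "(d has_derivative (\<lambda>h. h \<bullet> \<nu> (\<gamma> t))) (at (\<gamma> t))"
          using grad[OF inside strip, of t] that b by (simp add: gderiv_def inner_commute)
        moreover have "(\<gamma> has_derivative (\<lambda>h. h *\<^sub>R \<nu> x)) (at t)"
          unfolding \<gamma>_def by (auto intro!: derivative_eq_intros)
        ultimately have "((\<lambda>t. d (\<gamma> t)) has_derivative (\<lambda>h. (h *\<^sub>R \<nu> x) \<bullet> \<nu> (\<gamma> t))) (at t)"
          by (rule has_derivative_compose[rotated])
        then show ?thesis
          by simp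
      qed
      have cont: "continuous_on {0..b} (\<lambda>t. d (\<gamma> t))"
        using cont_d cont_\<gamma> by (rule continuous_on_compose2) auto
      obtain t where t: "0 < t" "t < b" "d (\<gamma> b) - d (\<gamma> 0) = (b - 0) * (\<nu> x \<bullet> \<nu> (\<gamma> t))"
        by (rule mvt[of 0 b "\<lambda>t. d (\<gamma> t)" "\<lambda>t h. h * (\<nu> x \<bullet> \<nu> (\<gamma> t))"])
          (use False b(1) der cont in auto)
      have "dist (\<nu> x) (\<nu> (\<gamma> t)) \<le> L * dist x (\<gamma> t)"
        using lip x dx inside[of t] strip[of t] t b by (intro lipschitz_onD[OF lip]) auto
      also have "\<dots> \<le> L * s\<^sub>0"
        using t b L norm_\<nu> by (intro mult_left_mono) (auto simp: \<gamma>_def dist_norm)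
      finally have near: "norm (\<nu> x - \<nu> (\<gamma> t)) \<le> 1 / 2"
        using s\<^sub>0 by (simp add: dist_norm)
      have "\<nu> x \<bullet> (\<nu> x - \<nu> (\<gamma> t)) \<le> 1 / 2"
        using Cauchy_Schwarz_ineq2[of "\<nu> x" "\<nu> x - \<nu> (\<gamma> t)"] near norm_\<nu> by simp
      then have "1 / 2 \<le> \<nu> x \<bullet> \<nu> (\<gamma> t)"
        using norm_\<nu> by (simp add: inner_diff_right dot_square_norm)
      then have "b * (1 / 2) \<le> b * (\<nu> x \<bullet> \<nu> (\<gamma> t))"
        using b by (intro mult_left_mono) auto
      moreover have "\<gamma> 0 = x"
        by (simp add: \<gamma>_def)
      ultimately show ?thesis
        using t(3) by simp
    qed (simp add: \<gamma>_def)
    \<comment> \<open>At the first exit time \<open>b\<close> the ray would be on the boundary, where \<open>d\<close>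
        vanishes, although \<open>d\<close> has been growing up to that time.\<close>
    have inside: "\<gamma> t \<in> \<Omega>" if "0 \<le> t" "t \<le> s\<^sub>0" for t
    proof (rule ccontr)
      assume "\<gamma> t \<notin> \<Omega>"
      define E where "E = {0..s\<^sub>0} \<inter> \<gamma> -` (- \<Omega>)"
      have "closed E"
        unfolding E_def using \<open>open \<Omega>\<close> cont_\<gamma> by (intro continuous_closed_preimage) auto
      then have "compact ({0..s\<^sub>0} \<inter> E)"
        by (intro compact_Int_closed) auto
      then have "compact E"
        by (simp add: E_def Int_assoc[symmetric])
      moreover have "E \<noteq> {}"
        using that \<open>\<gamma> t \<notin> \<Omega>\<close> by (auto simp: E_def)
      ultimately obtain b where b: "b \<in> E" "\<And>t. t \<in> E \<Longrightarrow> b \<le> t"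
        using compact_attains_inf[of E] by blast
      have before: "\<gamma> t \<in> \<Omega>" if "0 \<le> t" "t < b" for t
        using b(1) b(2)[of t] that by (auto simp: E_def)
      have "b > 0"
        using b(1) x(1) by (cases "b = 0") (auto simp: E_def \<gamma>_def)
      have "\<gamma> b \<in> closure \<Omega>"
      proof -
        have "\<gamma> ` closure {0..<b} \<subseteq> closure \<Omega>"
          using before cont_\<gamma> by (intro image_closure_subset) (auto intro: closure_subset[THEN subsetD])
        then show ?thesis
          using \<open>b > 0\<close> by (auto simp: closure_atLeastLessThan)
      qed
      then have "\<gamma> b \<in> frontier \<Omega>"
        using b(1) \<open>open \<Omega>\<close> by (simp add: E_def frontier_def interior_open)
      then have "d (\<gamma> b) = 0"
        by (simp add: d_def)
      moreover have "d x + b / 2 \<le> d (\<gamma> b)"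
        using b(1) before by (intro growth) (auto simp: E_def)
      moreover have "d x \<ge> 0"
        by (simp add: d_def infdist_nonneg)
      ultimately show False
        using \<open>b > 0\<close> by linarith
    qed
    then show ?thesis
      using growth[of \<tau>] \<tau> unfolding \<gamma>_def by auto
  qed
  show ?thesis
  proof (rule that[of L s\<^sub>0 \<nu>])
    show "L-lipschitz_on {x \<in> \<Omega>. infdist x (frontier \<Omega>) < s\<^sub>0} \<nu>"
      using s\<^sub>0 \<delta> by (intro lipschitz_on_subset[OF lip]) (auto simp: d_def)
    show "norm (\<nu> x) = 1" if "x \<in> \<Omega>" "infdist x (frontier \<Omega>) < s\<^sub>0" for x
      using unit[of x] that s\<^sub>0 by (simp add: d_def)
  qed (use L s\<^sub>0 ray in \<open>auto simp: d_def\<close>)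
qed

section \<open>Hoelder estimates up to the boundary\<close>

text \<open>The interior estimate compares two points only if both are far from the boundary relative to their
  distance. On a ray along which the distance to the boundary grows at rate 1/2, the points at the
  times \<open>s q^k\<close> with \<open>q = 9/10\<close> form a chain of admissible pairs: consecutive points are
  \<open>s q^k / 10\<close> apart, and twice that is less than \<open>s q^(k+1) / 2\<close>. The resulting
  increments of \<open>u\<close> are dominated by a geometric series of ratio \<open>q powr \<alpha>\<close>, so the constant
  depends on neither \<open>x\<close> nor \<open>s\<close>, although \<open>x\<close> may be arbitrarily close to the
  boundary.\<close>

lemma holder_along_ray:
  fixes u :: "'a::real_normed_vector \<Rightarrow> real"
  assumes "norm e = 1" "0 < s" "s \<le> r\<^sub>0" "K \<ge> 0" "\<alpha> > 0"
    and cont: "continuous_on \<Omega> u"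
    and interior: "\<And>x y. \<lbrakk>x \<in> \<Omega>; y \<in> \<Omega>; dist x y < r\<^sub>0;
        ereal (2 * dist x y) < bdry_dist \<Omega> x; ereal (2 * dist x y) < bdry_dist \<Omega> y\<rbrakk>
      \<Longrightarrow> \<bar>u x - u y\<bar> \<le> K * dist x y powr \<alpha>"
    and ray: "\<And>\<tau>. \<lbrakk>0 \<le> \<tau>; \<tau> \<le> s\<rbrakk> \<Longrightarrow>
      x + \<tau> *\<^sub>R e \<in> \<Omega> \<and> ereal (\<tau> / 2) \<le> bdry_dist \<Omega> (x + \<tau> *\<^sub>R e)"
  shows "\<bar>u (x + s *\<^sub>R e) - u x\<bar> \<le> K / (1 - (9/10) powr \<alpha>) * s powr \<alpha>"
proof -
  define \<theta> :: real where "\<theta> = (9/10) powr \<alpha>"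
  have \<theta>: "0 < \<theta>" "\<theta> < 1"
    using \<open>\<alpha> > 0\<close> powr_less_mono2[of \<alpha> "9/10" 1] by (auto simp: \<theta>_def)
  define \<tau> where "\<tau> k = s * (9/10) ^ k" for k :: nat
  define z where "z k = x + \<tau> k *\<^sub>R e" for k
  have \<tau>: "0 < \<tau> k" "\<tau> k \<le> s" "\<tau> (Suc k) = 9/10 * \<tau> k" for k
    using \<open>0 < s\<close> power_le_one[of "9/10 :: real" k] mult_left_mono[of "(9/10)^k" 1 s]
    by (auto simp: \<tau>_def)
  have z: "z k \<in> \<Omega>" "ereal (\<tau> k / 2) \<le> bdry_dist \<Omega> (z k)" for k
    using ray[of "\<tau> k"] \<tau>[of k] by (auto simp: z_def)
  have step: "\<bar>u (z (Suc k)) - u (z k)\<bar> \<le> K * s powr \<alpha> * \<theta> ^ k" for k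
  proof -
    have "dist (z (Suc k)) (z k) = norm ((\<tau> (Suc k) - \<tau> k) *\<^sub>R e)"
      unfolding z_def dist_norm by (simp add: scaleR_diff_left)
    also have "\<dots> = \<tau> k / 10"
      using \<tau>[of k] \<open>norm e = 1\<close> by simp
    finally have dist: "dist (z (Suc k)) (z k) = \<tau> k / 10" .
    have "ereal (2 * (\<tau> k / 10)) < bdry_dist \<Omega> (z j)" if "j = k \<or> j = Suc k" for j
    proof (rule less_le_trans)
      show "ereal (2 * (\<tau> k / 10)) < ereal (\<tau> j / 2)"
        using that \<tau>[of k] by auto
    qed (rule z)
    then have "\<bar>u (z (Suc k)) - u (z k)\<bar> \<le> K * (\<tau> k / 10) powr \<alpha>"
      using interior[of "z (Suc k)" "z k"] z \<tau>[of k] \<open>s \<le> r\<^sub>0\<close> by (simp add: dist)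
    also have "\<dots> \<le> K * \<tau> k powr \<alpha>"
      using \<tau>[of k] \<open>K \<ge> 0\<close> \<open>\<alpha> > 0\<close> by (intro mult_left_mono powr_mono2) auto
    also have "\<tau> k powr \<alpha> = s powr \<alpha> * \<theta> ^ k"
      using \<open>0 < s\<close> by (simp add: \<tau>_def \<theta>_def powr_mult powr_powr powr_power mult.commute
          flip: powr_realpow)
    finally show ?thesis
      by (simp add: mult.assoc)
  qed
  have partial: "\<bar>u (x + s *\<^sub>R e) - u (z n)\<bar> \<le> K / (1 - \<theta>) * s powr \<alpha>" for n
  proof -
    have "\<bar>u (z n) - u (z 0)\<bar> = \<bar>\<Sum>k<n. u (z (Suc k)) - u (z k)\<bar>"
      by (subst sum_lessThan_telescope) simp
    also have "\<dots> \<le> (\<Sum>k<n. K * s powr \<alpha> * \<theta> ^ k)"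
      using step by (intro order.trans[OF sum_abs] sum_mono)
    also have "\<dots> = K * s powr \<alpha> * ((1 - \<theta> ^ n) / (1 - \<theta>))"
      using \<theta> by (simp add: sum_gp_strict flip: sum_distrib_left)
    also have "\<dots> \<le> K * s powr \<alpha> * (1 / (1 - \<theta>))"
      using \<theta> \<open>K \<ge> 0\<close> by (intro mult_left_mono divide_right_mono) auto
    finally show ?thesis
      by (simp add: z_def \<tau>_def abs_minus_commute mult_ac)
  qed
  have "z \<longlonglongrightarrow> x + (s * 0) *\<^sub>R e"
    unfolding z_def \<tau>_def by (intro tendsto_intros LIMSEQ_power_zero) simp
  then have "(\<lambda>n. u (z n)) \<longlonglongrightarrow> u x"
    using cont z ray[of 0] \<open>0 < s\<close>
    by (intro continuous_on_tendsto_compose[OF cont]) auto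
  then have "(\<lambda>n. \<bar>u (x + s *\<^sub>R e) - u (z n)\<bar>) \<longlonglongrightarrow> \<bar>u (x + s *\<^sub>R e) - u x\<bar>"
    by (intro tendsto_intros)
  then show ?thesis
    using partial unfolding \<theta>_def by (intro LIMSEQ_le_const2) auto
qed

text \<open>Let \<open>t\<close> be the distance from \<open>x\<close> to \<open>y\<close>. If one of them is within
  \<open>2 * t\<close> of the boundary, push both inward along \<open>\<nu>\<close> by \<open>9 * t\<close>. As \<open>\<nu>\<close>
  is Lipschitz, the new points are at most \<open>3/2 * t\<close> apart, while their distance to the
  boundary is at least \<open>9/2 * t > 3 * t\<close>: the interior estimate applies to them, and the two
  displacements cost a multiple of \<open>t powr \<alpha>\<close> by the estimate along rays.\<close>

lemma uniform_holder_if_interior_holder: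
  fixes \<Omega> :: "(real^'n) set"
  assumes C11: "C11_domain \<Omega>"
    and "r\<^sub>0 > 0" "K \<ge> 0" "\<alpha> > 0" "\<alpha> \<le> 1"
    and cont: "continuous_on \<Omega> u"
    and interior: "\<And>x y. \<lbrakk>x \<in> \<Omega>; y \<in> \<Omega>; dist x y < r\<^sub>0;
        ereal (2 * dist x y) < bdry_dist \<Omega> x; ereal (2 * dist x y) < bdry_dist \<Omega> y\<rbrakk>
      \<Longrightarrow> \<bar>u x - u y\<bar> \<le> K * dist x y powr \<alpha>"
  obtains C \<rho> where "C \<ge> 0" "\<rho> > 0"
    and "\<And>x y. \<lbrakk>x \<in> \<Omega>; y \<in> \<Omega>; dist x y < \<rho>\<rbrakk> \<Longrightarrow> \<bar>u x - u y\<bar> \<le> C * dist x y powr \<alpha>"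
proof (cases "frontier \<Omega> = {}")
  case True
  show ?thesis
  proof (rule that[of K r\<^sub>0])
    show "\<bar>u x - u y\<bar> \<le> K * dist x y powr \<alpha>" if "x \<in> \<Omega>" "y \<in> \<Omega>" "dist x y < r\<^sub>0" for x y
      using interior[OF that] True by (simp add: bdry_dist_def)
  qed (use \<open>K \<ge> 0\<close> \<open>r\<^sub>0 > 0\<close> in auto)
next
  case False
  obtain L s\<^sub>0 \<nu> where L: "L \<ge> 0" and s\<^sub>0: "s\<^sub>0 > 0"
    and lip: "L-lipschitz_on {x \<in> \<Omega>. infdist x (frontier \<Omega>) < s\<^sub>0} \<nu>"
    and unit: "\<And>x. \<lbrakk>x \<in> \<Omega>; infdist x (frontier \<Omega>) < s\<^sub>0\<rbrakk> \<Longrightarrow> norm (\<nu> x) = 1"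
    and ray: "\<And>x \<tau>. \<lbrakk>x \<in> \<Omega>; infdist x (frontier \<Omega>) < s\<^sub>0; 0 \<le> \<tau>; \<tau> \<le> s\<^sub>0\<rbrakk>
      \<Longrightarrow> x + \<tau> *\<^sub>R \<nu> x \<in> \<Omega> \<and>
          infdist x (frontier \<Omega>) + \<tau> / 2 \<le> infdist (x + \<tau> *\<^sub>R \<nu> x) (frontier \<Omega>)"
    by (rule C11_domain_inward_field[OF C11 False]) (rule that; blast)
  define d where "d x = infdist x (frontier \<Omega>)" for x
  define C1 where "C1 = K / (1 - (9/10) powr \<alpha>)"
  have "(9/10) powr \<alpha> < (1::real)"
    using \<open>\<alpha> > 0\<close> powr_less_mono2[of \<alpha> "9/10" 1] by simp
  then have C1: "C1 \<ge> 0"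
    using \<open>K \<ge> 0\<close> by (simp add: C1_def)
  \<comment> \<open>The displacement \<open>9 * t\<close> is then at most \<open>r\<^sub>0\<close> and \<open>s\<^sub>0\<close>, and it
      enlarges the distance of the two points by at most \<open>t / 2\<close>.\<close>
  define \<rho> where "\<rho> = min (r\<^sub>0 / 9) (min (s\<^sub>0 / 9) (1 / (18 * (L + 1))))"
  have \<rho>: "\<rho> > 0" "9 * \<rho> \<le> r\<^sub>0" "9 * \<rho> \<le> s\<^sub>0" "9 * \<rho> * L \<le> 1 / 2"
  proof -
    show "\<rho> > 0" "9 * \<rho> \<le> r\<^sub>0" "9 * \<rho> \<le> s\<^sub>0"
      using s\<^sub>0 \<open>r\<^sub>0 > 0\<close> L by (auto simp: \<rho>_def)
    have "9 * \<rho> * L \<le> 9 * (1 / (18 * (L + 1))) * L"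
      using L by (intro mult_right_mono) (auto simp: \<rho>_def)
    also have "\<dots> \<le> 1 / 2"
      using L by (simp add: field_simps)
    finally show "9 * \<rho> * L \<le> 1 / 2" .
  qed
  have scale: "(c * t) powr \<alpha> \<le> c * t powr \<alpha>" if "c \<ge> 1" "t \<ge> 0" for c t :: real
  proof -
    have "c powr \<alpha> \<le> c powr 1"
      using that \<open>\<alpha> \<le> 1\<close> by (intro powr_mono) auto
    then show ?thesis
      using that by (auto simp: powr_mult intro: mult_right_mono)
  qed
  have main: "\<bar>u x - u y\<bar> \<le> (18 * C1 + 2 * K) * dist x y powr \<alpha>"
    if x: "x \<in> \<Omega>" and y: "y \<in> \<Omega>" and near: "dist x y < \<rho>" for x y
  proof -
    define t where "t = dist x y"
    have t: "t \<ge> 0" "t < \<rho>"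
      using near by (auto simp: t_def)
    consider "t = 0" | "2 * t < d x" "2 * t < d y" | "0 < t" "d x \<le> 2 * t \<or> d y \<le> 2 * t"
      using t by linarith
    then show ?thesis
    proof cases
      case 1
      then show ?thesis
        by (simp add: t_def)
    next
      case 2
      have "\<bar>u x - u y\<bar> \<le> K * t powr \<alpha>"
        using interior[OF x y] 2 t \<rho> by (simp add: t_def d_def bdry_dist_def)
      also have "\<dots> \<le> (18 * C1 + 2 * K) * t powr \<alpha>"
        using C1 \<open>K \<ge> 0\<close> by (intro mult_right_mono) auto
      finally show ?thesis
        by (simp add: t_def)
    next
      case 3
      define s where "s = 9 * t"
      have s: "0 < s" "s \<le> r\<^sub>0" "s \<le> s\<^sub>0" "s * L \<le> 1 / 2"
      proof -
        show "0 < s" "s \<le> r\<^sub>0" "s \<le> s\<^sub>0"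
          using 3 t \<rho> by (auto simp: s_def)
        have "s * L \<le> 9 * \<rho> * L"
          using t L by (intro mult_right_mono) (auto simp: s_def)
        then show "s * L \<le> 1 / 2"
          using \<rho> by linarith
      qed
      have "d x \<le> d y + t" "d y \<le> d x + t"
        using infdist_triangle[of x "frontier \<Omega>" y] infdist_triangle[of y "frontier \<Omega>" x]
        by (auto simp: d_def t_def dist_commute)
      then have d: "d x < s\<^sub>0" "d y < s\<^sub>0"
        using 3 s by (auto simp: s_def)
      define x' where "x' = x + s *\<^sub>R \<nu> x"
      define y' where "y' = y + s *\<^sub>R \<nu> y"
      have lift: "\<bar>u (p + s *\<^sub>R \<nu> p) - u p\<bar> \<le> C1 * s powr \<alpha>" if p: "p \<in> \<Omega>" "d p < s\<^sub>0" for p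
        unfolding C1_def
      proof (rule holder_along_ray[where r\<^sub>0 = r\<^sub>0 and \<Omega> = \<Omega>])
        show "norm (\<nu> p) = 1"
          using unit p by (simp add: d_def)
        show "p + \<tau> *\<^sub>R \<nu> p \<in> \<Omega> \<and> ereal (\<tau> / 2) \<le> bdry_dist \<Omega> (p + \<tau> *\<^sub>R \<nu> p)"
          if "0 \<le> \<tau>" "\<tau> \<le> s" for \<tau>
          using ray[of p \<tau>] that p s infdist_nonneg[of p "frontier \<Omega>"]
          by (auto simp: bdry_dist_def d_def)
      qed (use s \<open>K \<ge> 0\<close> \<open>\<alpha> > 0\<close> cont interior in auto)
      have "dist x' y' \<le> 3 / 2 * t"
      proof -
        have "norm (\<nu> x - \<nu> y) \<le> L * t"
          using lipschitz_onD[OF lip, of x y] x y d by (simp add: d_def dist_norm t_def)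
        then have "s * norm (\<nu> x - \<nu> y) \<le> s * (L * t)"
          using s by (intro mult_left_mono) auto
        also have "\<dots> \<le> 1 / 2 * t"
          using mult_right_mono[OF s(4) t(1)] by (simp add: mult_ac)
        finally have "norm (s *\<^sub>R (\<nu> x - \<nu> y)) \<le> 1 / 2 * t"
          using s by simp
        moreover have "x' - y' = (x - y) + s *\<^sub>R (\<nu> x - \<nu> y)"
          by (simp add: x'_def y'_def algebra_simps)
        ultimately show ?thesis
          using norm_triangle_ineq[of "x - y" "s *\<^sub>R (\<nu> x - \<nu> y)"] by (simp add: dist_norm t_def)
      qed
      moreover have "s / 2 \<le> d x'" "s / 2 \<le> d y'" and mem: "x' \<in> \<Omega>" "y' \<in> \<Omega>"
        using ray[of x s] ray[of y s] x y d s
          infdist_nonneg[of x "frontier \<Omega>"] infdist_nonneg[of y "frontier \<Omega>"]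
        by (auto simp: x'_def y'_def d_def)
      ultimately have "\<bar>u x' - u y'\<bar> \<le> K * dist x' y' powr \<alpha>"
        using s 3 by (intro interior) (auto simp: bdry_dist_def d_def s_def)
      also have "\<dots> \<le> K * (3 / 2 * t) powr \<alpha>"
        using \<open>dist x' y' \<le> 3 / 2 * t\<close> \<open>K \<ge> 0\<close> \<open>\<alpha> > 0\<close> by (intro mult_left_mono powr_mono2) auto
      also have "\<dots> \<le> K * (3 / 2 * t powr \<alpha>)"
        using scale[of "3/2" t] t \<open>K \<ge> 0\<close> by (intro mult_left_mono) auto
      also have "\<dots> \<le> 2 * K * t powr \<alpha>"
        using \<open>K \<ge> 0\<close> mult_right_mono[of "3/2 * K" "2 * K" "t powr \<alpha>"] by (simp add: mult_ac)
      finally have "\<bar>u x' - u y'\<bar> \<le> 2 * K * t powr \<alpha>" .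
      moreover have "C1 * s powr \<alpha> \<le> 9 * C1 * t powr \<alpha>"
        using mult_left_mono[OF scale[of 9 t] C1] t by (simp add: s_def mult_ac)
      moreover have "\<bar>u x' - u x\<bar> \<le> C1 * s powr \<alpha>" "\<bar>u y' - u y\<bar> \<le> C1 * s powr \<alpha>"
        using lift x y d by (auto simp: x'_def y'_def)
      ultimately have "\<bar>u x - u y\<bar> \<le> 2 * (9 * C1 * t powr \<alpha>) + 2 * K * t powr \<alpha>"
        by linarith
      also have "\<dots> = (18 * C1 + 2 * K) * t powr \<alpha>"
        by (simp add: algebra_simps)
      finally show ?thesis
        by (simp add: t_def)
    qed
  qed
  show ?thesis
    using main C1 \<open>K \<ge> 0\<close> \<rho>(1) by (intro that[of "18 * C1 + 2 * K" \<rho>]) auto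
qed

section \<open>Hoelder extension to the closure\<close>

text \<open>On a bounded set, pairs of points at distance at least \<open>\<rho>\<close> satisfy a Hoelder bound because
  \<open>f\<close> is bounded there; its oscillation, at most \<open>2 * M\<close>, is divided by \<open>\<rho> powr \<alpha>\<close>.\<close>

lemma C0_alpha_on_if_uniform_holder:
  fixes f :: "'a::heine_borel \<Rightarrow> real"
  assumes "uniformly_continuous_on S f" "\<alpha> > 0" "C \<ge> 0" "\<rho> > 0"
    and holder: "\<And>x y. \<lbrakk>x \<in> S; y \<in> S; dist x y < \<rho>\<rbrakk> \<Longrightarrow> \<bar>f x - f y\<bar> \<le> C * dist x y powr \<alpha>"
  shows "C0_alpha_on \<alpha> S f"
  unfolding C0_alpha_on_def
proof (intro conjI allI impI)
  fix T assume T: "T \<subseteq> S" "bounded T"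
  have "uniformly_continuous_on T f"
    using assms(1) T(1) unfolding uniformly_continuous_on_def by (meson subsetD)
  then have "bounded (f ` T)"
    using T(2) by (rule bounded_uniformly_continuous_image)
  then obtain M where M: "M > 0" "\<And>x. x \<in> T \<Longrightarrow> \<bar>f x\<bar> \<le> M"
    by (auto simp: bounded_pos)
  show "holder_on \<alpha> T f"
    unfolding holder_on_def
  proof (intro exI[of _ "C + 2 * M / \<rho> powr \<alpha>"] conjI ballI)
    fix x y assume xy: "x \<in> T" "y \<in> T"
    have split: "(C + 2 * M / \<rho> powr \<alpha>) * dist x y powr \<alpha>
        = C * dist x y powr \<alpha> + 2 * M * (dist x y powr \<alpha> / \<rho> powr \<alpha>)"
      by (simp add: field_simps)
    show "\<bar>f x - f y\<bar> \<le> (C + 2 * M / \<rho> powr \<alpha>) * dist x y powr \<alpha>"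
    proof (cases "dist x y < \<rho>")
      case True
      then have "\<bar>f x - f y\<bar> \<le> C * dist x y powr \<alpha>"
        using holder xy T by blast
      then show ?thesis
        unfolding split using M by (simp add: add_increasing2)
    next
      case False
      then have "\<rho> powr \<alpha> \<le> dist x y powr \<alpha>"
        using assms by (intro powr_mono2) auto
      then have "1 \<le> dist x y powr \<alpha> / \<rho> powr \<alpha>"
        using \<open>\<rho> > 0\<close> by simp
      then have "2 * M * 1 \<le> 2 * M * (dist x y powr \<alpha> / \<rho> powr \<alpha>)"
        using M by (intro mult_left_mono) auto
      moreover have "\<bar>f x - f y\<bar> \<le> 2 * M"
        using M(2)[OF xy(1)] M(2)[OF xy(2)] by linarith
      moreover have "0 \<le> C * dist x y powr \<alpha>"
        using \<open>C \<ge> 0\<close> by simp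
      ultimately show ?thesis
        unfolding split by linarith
    qed
  qed (use M \<open>C \<ge> 0\<close> in auto)
next
  show "\<exists>C\<ge>0. \<exists>\<rho>>0. \<forall>x\<in>S. \<forall>y\<in>S. dist x y < \<rho> \<longrightarrow> \<bar>f x - f y\<bar> \<le> C * dist x y powr \<alpha>"
    using assms(3,4) holder by blast
qed

lemma C0_alpha_on_closure_extension:
  fixes u :: "'a::heine_borel \<Rightarrow> real"
  assumes "\<alpha> > 0" "C \<ge> 0" "\<rho> > 0"
    and holder: "\<And>x y. \<lbrakk>x \<in> \<Omega>; y \<in> \<Omega>; dist x y < \<rho>\<rbrakk> \<Longrightarrow> \<bar>u x - u y\<bar> \<le> C * dist x y powr \<alpha>"
  shows "\<exists>u'. (\<forall>x\<in>\<Omega>. u' x = u x) \<and> C0_alpha_on \<alpha> (closure \<Omega>) u'"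
proof -
  have "uniformly_continuous_on \<Omega> u"
    unfolding uniformly_continuous_on_def
  proof (intro allI impI)
    fix \<epsilon> :: real assume "\<epsilon> > 0"
    define \<delta> where "\<delta> = min \<rho> ((\<epsilon> / (C + 1)) powr (1 / \<alpha>))"
    have "\<delta> > 0"
      using \<open>\<epsilon> > 0\<close> assms by (simp add: \<delta>_def)
    moreover have "dist (u x') (u x) < \<epsilon>" if "x \<in> \<Omega>" "x' \<in> \<Omega>" "dist x' x < \<delta>" for x x'
    proof -
      have "dist x' x powr \<alpha> \<le> ((\<epsilon> / (C + 1)) powr (1 / \<alpha>)) powr \<alpha>"
        using that \<open>\<alpha> > 0\<close> by (intro powr_mono2) (auto simp: \<delta>_def)
      also have "\<dots> = \<epsilon> / (C + 1)"
        using \<open>\<alpha> > 0\<close> \<open>\<epsilon> > 0\<close> \<open>C \<ge> 0\<close> by (simp add: powr_powr)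
      finally have "C * dist x' x powr \<alpha> \<le> C * (\<epsilon> / (C + 1))"
        using \<open>C \<ge> 0\<close> by (rule mult_left_mono)
      also have "\<dots> < \<epsilon>"
        using \<open>\<epsilon> > 0\<close> \<open>C \<ge> 0\<close> by (simp add: field_simps)
      finally show ?thesis
        using holder[of x' x] that by (simp add: \<delta>_def dist_real_def)
    qed
    ultimately show "\<exists>\<delta>>0. \<forall>x\<in>\<Omega>. \<forall>x'\<in>\<Omega>. dist x' x < \<delta> \<longrightarrow> dist (u x') (u x) < \<epsilon>"
      by blast
  qed
  then obtain u' where uc: "uniformly_continuous_on (closure \<Omega>) u'"
    and eq: "\<And>x. x \<in> \<Omega> \<Longrightarrow> u x = u' x"
    using uniformly_continuous_on_extension_on_closure by metis
  have cont: "continuous_on (closure \<Omega>) u'"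
    using uc by (rule uniformly_continuous_imp_continuous)
  have "\<bar>u' x - u' y\<bar> \<le> C * dist x y powr \<alpha>"
    if xy: "x \<in> closure \<Omega>" "y \<in> closure \<Omega>" "dist x y < \<rho>" for x y
  proof -
    obtain X Y where X: "\<And>n. X n \<in> \<Omega>" "X \<longlonglongrightarrow> x" and Y: "\<And>n. Y n \<in> \<Omega>" "Y \<longlonglongrightarrow> y"
      using xy unfolding closure_sequential by metis
    have lim: "(\<lambda>n. dist (X n) (Y n)) \<longlonglongrightarrow> dist x y"
      by (intro tendsto_intros X Y)
    show ?thesis
    proof (rule tendsto_le[OF sequentially_bot])
      show "(\<lambda>n. C * dist (X n) (Y n) powr \<alpha>) \<longlonglongrightarrow> C * dist x y powr \<alpha>"
        using \<open>\<alpha> > 0\<close> by (intro tendsto_mult_left tendsto_powr' lim tendsto_const) auto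
      have "(\<lambda>n. u' (X n)) \<longlonglongrightarrow> u' x" "(\<lambda>n. u' (Y n)) \<longlonglongrightarrow> u' y"
        using X Y xy subsetD[OF closure_subset, of _ \<Omega>]
        by (auto intro!: continuous_on_tendsto_compose[OF cont])
      then show "(\<lambda>n. \<bar>u' (X n) - u' (Y n)\<bar>) \<longlonglongrightarrow> \<bar>u' x - u' y\<bar>"
        by (intro tendsto_intros)
      show "\<forall>\<^sub>F n in sequentially. \<bar>u' (X n) - u' (Y n)\<bar> \<le> C * dist (X n) (Y n) powr \<alpha>"
        using order_tendstoD(2)[OF lim xy(3)] by eventually_elim (use X Y eq holder in metis)
    qed
  qed
  then have "C0_alpha_on \<alpha> (closure \<Omega>) u'"
    using uc assms(1-3) by (intro C0_alpha_on_if_uniform_holder[where C = C and \<rho> = \<rho>]) auto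
  then show ?thesis
    using eq by auto
qed

section \<open>Regularity of subsolutions\<close>

theorem proposition2p1:
  fixes \<Omega> :: "(real^'n) set"
    and F :: "real^'n^'n \<Rightarrow> real^'n \<Rightarrow> real \<Rightarrow> real^'n \<Rightarrow> real"
    and u :: "real^'n \<Rightarrow> real"
    and r\<^sub>0 :: real
    and G :: "real \<Rightarrow> real^'n^'n \<Rightarrow> real^'n \<Rightarrow> real"
    and w :: "real \<Rightarrow> real^'n \<Rightarrow> real"
    and \<eta> :: "real \<Rightarrow> real"
  assumes "open \<Omega>"
    and F_continuous:
      "continuous_on (symmetric_matrices \<times> UNIV \<times> UNIV \<times> \<Omega>) (\<lambda>(X, p, s, x). F X p s x)"
    and F_elliptic:
      "\<And>X Y p s x. \<lbrakk>X \<in> symmetric_matrices; Y \<in> symmetric_matrices; loewner_le Y X; x \<in> \<Omega>\<rbrakk>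
         \<Longrightarrow> F X p s x \<le> F Y p s x"
    and u_locally_bounded: "locally_bounded_on \<Omega> u"
    and u_usc: "usc_on \<Omega> u"
    and u_subsolution: "viscosity_subsolution F \<Omega> u"
    and "r\<^sub>0 > 0"
    and H1_2_continuous:
      "\<And>r. \<lbrakk>0 < r; r \<le> r\<^sub>0\<rbrakk> \<Longrightarrow>
         continuous_on (symmetric_matrices \<times> UNIV) (\<lambda>(X, p). G r X p)"
    and H1_2_elliptic:
      "\<And>r X Y p. \<lbrakk>0 < r; r \<le> r\<^sub>0; X \<in> symmetric_matrices; Y \<in> symmetric_matrices; loewner_le Y X\<rbrakk>
         \<Longrightarrow> G r X p \<le> G r Y p"
    and H1_2_subsolution:
      "\<And>r x. \<lbrakk>0 < r; r \<le> r\<^sub>0; x \<in> \<Omega>; ereal (2 * r) \<le> bdry_dist \<Omega> x\<rbrakk>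
         \<Longrightarrow> viscosity_subsolution (\<lambda>X p s y. G r X p) (ball x r) u"
    and H2_continuous: "\<And>r. \<lbrakk>0 < r; r \<le> r\<^sub>0\<rbrakk> \<Longrightarrow> continuous_on (cball 0 r) (w r)"
    and H2_zero: "\<And>r. \<lbrakk>0 < r; r \<le> r\<^sub>0\<rbrakk> \<Longrightarrow> w r 0 = 0"
    and H2_nonneg: "\<And>r y. \<lbrakk>0 < r; r \<le> r\<^sub>0; y \<in> ball 0 r\<rbrakk> \<Longrightarrow> 0 \<le> w r y"
    and H2_eta: "\<And>r. \<lbrakk>0 < r; r \<le> r\<^sub>0\<rbrakk> \<Longrightarrow> \<eta> r > 0"
    and H2_supersolution:
      "\<And>r. \<lbrakk>0 < r; r \<le> r\<^sub>0\<rbrakk> \<Longrightarrow> state_constraint_supersolution (G r) (\<eta> r) (cball 0 r) (w r)"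
    and H3:
      "\<And>r v y. \<lbrakk>0 < r; r \<le> r\<^sub>0; bounded (v ` ball 0 r); usc_on (ball 0 r) v;
          viscosity_subsolution (\<lambda>X p s z. G r X p) (ball 0 r - {0}) v; y \<in> ball 0 r\<rbrakk>
         \<Longrightarrow> v y \<le> v 0 + w r y"
  shows
    "(\<forall>x\<in>\<Omega>. \<forall>r. 0 < r \<and> r \<le> r\<^sub>0 \<and> ereal (2 * r) \<le> bdry_dist \<Omega> x \<longrightarrow>
        (\<forall>y\<in>ball x r. u y \<le> u x + w r (y - x)))
   \<and> (\<forall>\<delta>>0.
        uniformly_continuous_on (closure (inner_set \<Omega> \<delta>)) u \<and>
        (\<delta> / 2 \<le> r\<^sub>0 \<and>
         (\<forall>s\<in>cball 0 (\<delta> / 2). \<forall>s'\<in>cball 0 (\<delta> / 2). norm s = norm s' \<longrightarrow> w (\<delta> / 2) s = w (\<delta> / 2) s') \<longrightarrow>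
         (\<forall>x\<in>closure (inner_set \<Omega> \<delta>). \<forall>y\<in>closure (inner_set \<Omega> \<delta>).
            dist x y < \<delta> / 2 \<longrightarrow> \<bar>u y - u x\<bar> \<le> w (\<delta> / 2) (y - x))))
   \<and> (\<forall>K \<alpha>. K > 0 \<and> 0 < \<alpha> \<and> \<alpha> \<le> 1 \<and> C11_domain \<Omega> \<and>
        (\<forall>r. 0 < r \<and> r \<le> r\<^sub>0 \<longrightarrow> (\<forall>s\<in>cball 0 r. w r s \<le> K * norm s powr \<alpha>)) \<longrightarrow>
        (\<exists>u'. (\<forall>x\<in>\<Omega>. u' x = u x) \<and> C0_alpha_on \<alpha> (closure \<Omega>) u'))"
proof (intro conjI ballI allI impI; (elim conjE)?)
  have one_sided: "u y \<le> u x + w r (y - x)"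
    if x: "x \<in> \<Omega>" and r: "0 < r" "r \<le> r\<^sub>0" and far: "ereal (2 * r) \<le> bdry_dist \<Omega> x"
      and y: "y \<in> ball x r" for x y r
  proof -
    have "ereal r < ereal (2 * r)"
      using r by simp
    then have "ereal r < bdry_dist \<Omega> x"
      using far by (rule less_le_trans)
    then have sub: "cball x r \<subseteq> \<Omega>"
      using x by (intro cball_subset_if_lt_bdry_dist)
    have "bounded (u ` cball x r)"
      using locally_bounded_on_compact_subset[OF u_locally_bounded compact_cball sub] .
    moreover have "(\<lambda>z. u (x + z)) ` ball 0 r \<subseteq> u ` cball x r"
      by (auto simp: dist_norm)
    ultimately have "bounded ((\<lambda>z. u (x + z)) ` ball 0 r)"
      by (rule bounded_subset)
    moreover have "usc_on (ball 0 r) (\<lambda>z. u (x + z))"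
      using sub ball_subset_cball by (intro usc_on_translate[OF u_usc]) blast
    moreover have "viscosity_subsolution (\<lambda>X p s z. G r X p) (ball 0 r - {0}) (\<lambda>z. u (x + z))"
      by (rule viscosity_subsolution_translate[OF H1_2_subsolution[OF r x far]])
    moreover have "y - x \<in> ball 0 r"
      using y by (simp add: dist_norm norm_minus_commute)
    ultimately show ?thesis
      using H3[OF r, of "\<lambda>z. u (x + z)" "y - x"] by simp
  qed
  show "u y \<le> u x + w r (y - x)"
    if "x \<in> \<Omega>" "0 < r" "r \<le> r\<^sub>0" "ereal (2 * r) \<le> bdry_dist \<Omega> x" "y \<in> ball x r" for x r y
    using one_sided that by blast

  have inner_modulus: "u y \<le> u x + w r (y - x)"
    if r: "0 < r" "r \<le> r\<^sub>0" "2 * r \<le> \<delta>"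
      and "x \<in> closure (inner_set \<Omega> \<delta>)" "dist x y < r" for x y r \<delta>
  proof -
    have "\<delta> > 0"
      using r by linarith
    then have "x \<in> \<Omega>" "ereal \<delta> \<le> bdry_dist \<Omega> x"
      using mem_closure_inner_setD[OF \<open>open \<Omega>\<close>] that by blast+
    moreover have "ereal (2 * r) \<le> ereal \<delta>"
      using r by simp
    ultimately have "ereal (2 * r) \<le> bdry_dist \<Omega> x"
      using order.trans by blast
    then show ?thesis
      using \<open>x \<in> \<Omega>\<close> r that by (intro one_sided) auto
  qed
  show uc: "uniformly_continuous_on (closure (inner_set \<Omega> \<delta>)) u" if "0 < \<delta>" for \<delta>
  proof -
    define r where "r = min (\<delta> / 2) r\<^sub>0"
    have r: "0 < r" "r \<le> r\<^sub>0" "2 * r \<le> \<delta>"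
      using that \<open>r\<^sub>0 > 0\<close> by (auto simp: r_def)
    show ?thesis
      using inner_modulus[OF r] r H2_continuous H2_zero
      by (intro uniformly_continuous_on_if_modulus[of r "w r"]) auto
  qed
  show "\<bar>u y - u x\<bar> \<le> w (\<delta> / 2) (y - x)"
    if "0 < \<delta>" "\<delta> / 2 \<le> r\<^sub>0"
      and radial: "\<forall>s\<in>cball 0 (\<delta> / 2). \<forall>s'\<in>cball 0 (\<delta> / 2).
        norm s = norm s' \<longrightarrow> w (\<delta> / 2) s = w (\<delta> / 2) s'"
      and x: "x \<in> closure (inner_set \<Omega> \<delta>)" and y: "y \<in> closure (inner_set \<Omega> \<delta>)"
      and near: "dist x y < \<delta> / 2" for \<delta> x y
  proof -
    have "w (\<delta> / 2) (x - y) = w (\<delta> / 2) (y - x)"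
      using near by (intro radial[rule_format]) (auto simp: dist_norm norm_minus_commute)
    moreover have "u y \<le> u x + w (\<delta> / 2) (y - x)"
      using that by (intro inner_modulus[of "\<delta> / 2" \<delta>]) auto
    moreover have "u x \<le> u y + w (\<delta> / 2) (x - y)"
      using that by (intro inner_modulus[of "\<delta> / 2" \<delta>]) (auto simp: dist_commute)
    ultimately show ?thesis
      by linarith
  qed

  show "\<exists>u'. (\<forall>x\<in>\<Omega>. u' x = u x) \<and> C0_alpha_on \<alpha> (closure \<Omega>) u'"
    if "K > 0" "0 < \<alpha>" "\<alpha> \<le> 1" and C11: "C11_domain \<Omega>"
      and power: "\<forall>r. 0 < r \<and> r \<le> r\<^sub>0 \<longrightarrow> (\<forall>s\<in>cball 0 r. w r s \<le> K * norm s powr \<alpha>)"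
    for K \<alpha>
  proof -
    have "continuous_on (inner_set \<Omega> \<delta>) u" if "\<delta> > 0" for \<delta>
      using uniformly_continuous_imp_continuous[OF uc[OF that]] closure_subset
      by (rule continuous_on_subset)
    then have "continuous_on (\<Union>\<delta>\<in>{0<..}. inner_set \<Omega> \<delta>) u"
      using open_inner_set[OF \<open>open \<Omega>\<close>] by (intro continuous_on_open_UN) auto
    then have cont: "continuous_on \<Omega> u"
      by (simp add: UN_inner_set[OF \<open>open \<Omega>\<close>])
    have interior: "\<bar>u x - u y\<bar> \<le> K * dist x y powr \<alpha>"
      if x: "x \<in> \<Omega>" and y: "y \<in> \<Omega>" and near: "dist x y < r\<^sub>0"
        and far: "ereal (2 * dist x y) < bdry_dist \<Omega> x" "ereal (2 * dist x y) < bdry_dist \<Omega> y"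
      for x y
    proof -
      \<comment> \<open>The largest radius for which the one-sided estimate is available at both points.\<close>
      define r where "r = (if frontier \<Omega> = {} then r\<^sub>0
        else min r\<^sub>0 (min (infdist x (frontier \<Omega>) / 2) (infdist y (frontier \<Omega>) / 2)))"
      have near_r: "dist x y < r" and "r \<le> r\<^sub>0"
        and r_far: "ereal (2 * r) \<le> bdry_dist \<Omega> x" "ereal (2 * r) \<le> bdry_dist \<Omega> y"
        using near far by (auto simp: r_def bdry_dist_def split: if_splits)
      have "0 < r"
        using near_r zero_le_dist[of x y] by linarith
      have "w r (y - x) \<le> K * dist x y powr \<alpha>" "w r (x - y) \<le> K * dist x y powr \<alpha>"
        using power[rule_format, of r "y - x"] power[rule_format, of r "x - y"]
          near_r \<open>0 < r\<close> \<open>r \<le> r\<^sub>0\<close> by (auto simp: dist_norm norm_minus_commute)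
      moreover have "u y \<le> u x + w r (y - x)"
        using near_r by (intro one_sided x \<open>0 < r\<close> \<open>r \<le> r\<^sub>0\<close> r_far) auto
      moreover have "u x \<le> u y + w r (x - y)"
        using near_r by (intro one_sided y \<open>0 < r\<close> \<open>r \<le> r\<^sub>0\<close> r_far) (auto simp: dist_commute)
      ultimately show ?thesis
        by linarith
    qed
    show ?thesis
    proof (rule uniform_holder_if_interior_holder[OF C11 \<open>r\<^sub>0 > 0\<close> less_imp_le[OF \<open>K > 0\<close>]
          \<open>0 < \<alpha>\<close> \<open>\<alpha> \<le> 1\<close> cont])
      show ?thesis
        if "C \<ge> 0" "\<rho> > 0"
          and "\<And>x y. \<lbrakk>x \<in> \<Omega>; y \<in> \<Omega>; dist x y < \<rho>\<rbrakk> \<Longrightarrow> \<bar>u x - u y\<bar> \<le> C * dist x y powr \<alpha>"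
        for C \<rho>
        using that by (rule C0_alpha_on_closure_extension[OF \<open>0 < \<alpha>\<close>])
    qed (rule interior)
  qed
qed

end
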